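(* Let $a,b,c$ be integers with $0<a<b<c$, let $f=\gcd(a,b,c)$, and for $z\in\mathbb{C}$ let $$A(z)=\begin{pmatrix} a & z^{a}-1\\ b & z^{b}-1\\ c & z^{c}-1\end{pmatrix}.$$ Then the rank of $A(z)$ is $1$ if and only if $z^f=1$. *)

theory Defs
  imports "HOL-Analysis.Analysis"
begin

definition A_mat :: "int \<Rightarrow> int \<Rightarrow> int \<Rightarrow> complex \<Rightarrow> complex^2^3" where
  "A_mat a b c z =
     vector [vector [of_int a, z powi a - 1],
             vector [of_int b, z powi b - 1],
             vector [of_int c, z powi c - 1]]"

end

theory Submission
  imports Defs
begin

text \<open>
  The first column of \<open>A(z)\<close> has no zero entry, so the rank is \<open>1\<close> exactly when the second column
  is a multiple \<open>t\<close> of the first, that is, when \<open>z\<^sup>n = 1 + n t\<close> for \<open>n = a, b, c\<close>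
  (lemma \<open>rank_eq_1_iff_rows_in_span\<close>). This relation also holds for \<open>n = 0\<close>, and it excludes
  \<open>z = 0\<close>, where it would give \<open>a t = b t = -1\<close>. Taking squared absolute values, the function
  \<open>s \<mapsto> \<bar>z\<bar>\<^bsup>2s\<^esup>\<close>, which is an exponential, agrees with the quadratic polynomial
  \<open>s \<mapsto> \<bar>1 + s t\<bar>\<^sup>2\<close> at the four points \<open>0, a, b, c\<close>. By Rolle's theorem, applied three times, the
  third derivative of their difference, which is that of the exponential, vanishes somewhere;
  hence \<open>\<bar>z\<bar> = 1\<close> (lemma \<open>exp_eq_quadratic_at_four_points\<close>). If \<open>t\<close> were not zero, the four
  points \<open>1 + n t\<close> of a line would then be distinct and lie on the unit circle, which is impossible.

  So the rank is \<open>1\<close> only if \<open>z\<^sup>a = z\<^sup>b = z\<^sup>c = 1\<close>, and by Bezout's identity this means \<open>z\<^sup>f = 1\<close>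
  (lemma \<open>power_int_gcd_eq_1_iff\<close>). The converse is immediate, as then the second column is zero.
\<close>

lemma rank_eq_1_iff_rows_in_span:
  fixes A :: "'a::field^'n^'m"
  assumes "row i A \<noteq> 0"
  shows "rank A = 1 \<longleftrightarrow> (\<forall>j. \<exists>k. row j A = k *s row i A)"
proof
  have ind: "vec.independent {row i A}"
    using assms by simp
  {
    assume "rank A = 1"
    then have "rows A \<subseteq> vec.span {row i A}"
      using ind by (intro vec.card_ge_dim_independent) (auto simp: row_rank_def_gen rows_def)
    then show "\<forall>j. \<exists>k. row j A = k *s row i A"
      by (auto simp: rows_def vec.span_singleton)
  next
    assume "\<forall>j. \<exists>k. row j A = k *s row i A"
    then have "rows A \<subseteq> vec.span {row i A}"
      by (auto simp: rows_def vec.span_singleton)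
    then have "vec.dim (rows A) = card {row i A}"
      using ind by (intro vec.dim_unique[of "{row i A}"]) (auto simp: rows_def)
    then show "rank A = 1"
      by (simp add: row_rank_def_gen)
  }
qed

lemma Rolle_DERIV:
  fixes g g' :: "real \<Rightarrow> real"
  assumes "\<And>x. DERIV g x :> g' x" and "x < y" and "g x = 0" and "g y = 0"
  obtains u where "x < u" and "u < y" and "g' u = 0"
proof -
  have "continuous_on {x..y} g"
    using assms(1) by (meson DERIV_isCont continuous_at_imp_continuous_on)
  then obtain u where "x < u" "u < y" "DERIV g u :> 0"
    using Rolle[of x y g] assms real_differentiable_def by metis
  then show thesis
    using that DERIV_unique assms(1) by blast
qed

text \<open>
  The third derivative \<open>k\<^sup>3 e\<^bsup>k s\<^esup>\<close> of the difference of the two sides has no zero unless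
  \<open>k = 0\<close>, while each differentiation costs at most one of the four zeros.
\<close>

lemma exp_eq_quadratic_at_four_points:
  fixes k p q r x0 x1 x2 x3 :: real
  assumes "x0 < x1" "x1 < x2" "x2 < x3"
    and "\<And>x. x \<in> {x0, x1, x2, x3} \<Longrightarrow> exp (k * x) = p + q * x + r * x\<^sup>2"
  shows "k = 0"
proof -
  define g0 where "g0 x = exp (k * x) - (p + q * x + r * x\<^sup>2)" for x
  define g1 where "g1 x = k * exp (k * x) - (q + 2 * r * x)" for x
  define g2 where "g2 x = k\<^sup>2 * exp (k * x) - 2 * r" for x
  define g3 where "g3 x = k ^ 3 * exp (k * x)" for x
  have d0: "DERIV g0 x :> g1 x" for x
    unfolding g0_def g1_def by (auto intro!: derivative_eq_intros)
  have d1: "DERIV g1 x :> g2 x" for x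
    unfolding g1_def g2_def by (auto intro!: derivative_eq_intros simp: power2_eq_square)
  have d2: "DERIV g2 x :> g3 x" for x
    unfolding g2_def g3_def
    by (auto intro!: derivative_eq_intros simp: power2_eq_square power3_eq_cube)
  have zeros: "g0 x0 = 0" "g0 x1 = 0" "g0 x2 = 0" "g0 x3 = 0"
    using assms(4) by (auto simp: g0_def)
  obtain u0 where u0: "u0 < x1" "g1 u0 = 0"
    using Rolle_DERIV[OF d0 assms(1)] zeros by blast
  obtain u1 where u1: "x1 < u1" "u1 < x2" "g1 u1 = 0"
    using Rolle_DERIV[OF d0 assms(2)] zeros by blast
  obtain u2 where u2: "x2 < u2" "g1 u2 = 0"
    using Rolle_DERIV[OF d0 assms(3)] zeros by blast
  obtain v0 where v0: "v0 < u1" "g2 v0 = 0"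
    using Rolle_DERIV[OF d1, of u0 u1] u0 u1 by force
  obtain v1 where v1: "u1 < v1" "g2 v1 = 0"
    using Rolle_DERIV[OF d1, of u1 u2] u1 u2 by force
  obtain w where "g3 w = 0"
    using Rolle_DERIV[OF d2, of v0 v1] v0 v1 by force
  then show "k = 0"
    by (simp add: g3_def)
qed

lemma cmod_one_plus_real_mult_power2:
  "(cmod (1 + of_real s * t))\<^sup>2 = 1 + 2 * Re t * s + (cmod t)\<^sup>2 * s\<^sup>2"
  unfolding cmod_power2 by (simp add: power2_eq_square algebra_simps)

text \<open>
  Only the moduli of the powers are needed: as \<open>n = 0\<close> satisfies the equation as well, the
  exponential \<open>n \<mapsto> \<bar>z\<bar>\<^bsup>2n\<^esup>\<close> agrees with the quadratic polynomial \<open>n \<mapsto> \<bar>1 + n t\<bar>\<^sup>2\<close> at four points.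
  Hence \<open>\<bar>z\<bar> = 1\<close>, and the line \<open>n \<mapsto> 1 + n t\<close> would meet the unit circle more than twice
  if \<open>t\<close> were not zero.
\<close>

lemma power_int_affine_at_three_points:
  fixes a b c :: int and z t :: complex
  assumes "0 < a" "a < b" "b < c"
    and eq: "\<And>n. n \<in> {a, b, c} \<Longrightarrow> z powi n = 1 + of_int n * t"
  shows "t = 0"
proof -
  have "z \<noteq> 0"
  proof
    assume "z = 0"
    then have "of_int a * t = -1" "of_int b * t = -1"
      using eq[of a] eq[of b] assms(1,2) by (auto simp: eq_neg_iff_add_eq_0 add.commute)
    then have "of_int (b - a) * t = 0" "t \<noteq> 0"
      by (auto simp: algebra_simps)
    then show False
      using assms(2) by simp
  qed
  have expand: "exp (2 * ln (cmod z) * of_int n) = 1 + 2 * Re t * of_int n + (cmod t)\<^sup>2 * (of_int n)\<^sup>2"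
    if "n \<in> {0, a, b, c}" for n :: int
  proof -
    have "exp (2 * ln (cmod z) * of_int n) = (exp (ln (cmod z) * of_int n))\<^sup>2"
      by (simp add: power2_eq_square flip: exp_add)
    also have "exp (ln (cmod z) * of_int n) = cmod z powi n"
      using \<open>z \<noteq> 0\<close> by (simp add: powr_def mult.commute flip: powr_real_of_int')
    also have "\<dots> = cmod (1 + of_real (of_int n) * t)"
      using eq[of n] that by (auto simp flip: norm_power_int)
    finally show ?thesis
      by (simp only: cmod_one_plus_real_mult_power2)
  qed
  have "2 * ln (cmod z) = 0"
  proof (rule exp_eq_quadratic_at_four_points)
    show "(0::real) < of_int a" "real_of_int a < of_int b" "real_of_int b < of_int c"
      using assms by auto
    show "exp (2 * ln (cmod z) * x) = 1 + 2 * Re t * x + (cmod t)\<^sup>2 * x\<^sup>2"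
      if "x \<in> {0, of_int a, of_int b, of_int c}" for x
      using that expand[of 0] expand[of a] expand[of b] expand[of c] by auto
  qed
  \<comment> \<open>Now the quadratic takes the value \<open>1\<close> at \<open>0\<close>, \<open>a\<close> and \<open>b\<close>, so its leading coefficient
     vanishes.\<close>
  then have *: "of_int n * (2 * Re t + (cmod t)\<^sup>2 * of_int n) = 0" if "n \<in> {a, b}" for n
    using expand[of n] that by (auto simp: power2_eq_square algebra_simps)
  have "2 * Re t + (cmod t)\<^sup>2 * of_int a = 0" "2 * Re t + (cmod t)\<^sup>2 * of_int b = 0"
    using *[of a] *[of b] assms(1,2) by auto
  then have "(cmod t)\<^sup>2 * of_int a = (cmod t)\<^sup>2 * of_int b"
    by linarith
  then show "t = 0"
    using assms(2) by simp
qed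

lemma power_int_gcd_eq_1_iff:
  fixes z :: "'a::field"
  shows "z powi gcd m n = 1 \<longleftrightarrow> z powi m = 1 \<and> z powi n = 1"
proof (cases "z = 0")
  case True
  then show ?thesis
    by (auto simp: power_int_0_left_if)
next
  case False
  show ?thesis
  proof
    assume "z powi gcd m n = 1"
    then show "z powi m = 1 \<and> z powi n = 1"
      by (metis dvdE gcd_dvd1 gcd_dvd2 power_int_1_left power_int_mult)
  next
    assume *: "z powi m = 1 \<and> z powi n = 1"
    obtain u v where "u * m + v * n = gcd m n"
      using bezout_int by blast
    then have "z powi gcd m n = (z powi m) powi u * (z powi n) powi v"
      using False by (metis mult.commute power_int_add power_int_mult)
    then show "z powi gcd m n = 1"
      using * by simp
  qed
qed

lemma row_A_mat:
  "row 1 (A_mat a b c z) = vector [of_int a, z powi a - 1]"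
  "row 2 (A_mat a b c z) = vector [of_int b, z powi b - 1]"
  "row 3 (A_mat a b c z) = vector [of_int c, z powi c - 1]"
  by (simp_all add: row_def A_mat_def)

theorem lemma1p1:
  fixes a b c f :: int and z :: complex
  assumes "0 < a" and "a < b" and "b < c"
    and "f = gcd a (gcd b c)"
  shows "rank (A_mat a b c z) = 1 \<longleftrightarrow> z powi f = 1"
proof -
  have "row 1 (A_mat a b c z) \<noteq> 0"
    using assms(1) by (auto simp: row_A_mat vec_eq_iff forall_2)
  then have rank: "rank (A_mat a b c z) = 1 \<longleftrightarrow>
      (\<forall>j. \<exists>k. row j (A_mat a b c z) = k *s row 1 (A_mat a b c z))"
    by (rule rank_eq_1_iff_rows_in_span)
  have powers: "z powi f = 1 \<longleftrightarrow> z powi a = 1 \<and> z powi b = 1 \<and> z powi c = 1"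
    by (simp add: assms(4) power_int_gcd_eq_1_iff)
  show ?thesis
  proof
    assume "rank (A_mat a b c z) = 1"
    then obtain k l where k: "of_int b = k * of_int a" "z powi b - 1 = k * (z powi a - 1)"
      and l: "of_int c = l * of_int a" "z powi c - 1 = l * (z powi a - 1)"
      unfolding rank forall_3 row_A_mat by (auto simp: vec_eq_iff forall_2)
    define t where "t = (z powi a - 1) / of_int a"
    have za: "z powi a - 1 = of_int a * t"
      using assms(1) by (simp add: t_def)
    have eq: "z powi n = 1 + of_int n * t" if "n \<in> {a, b, c}" for n
      using that za k l by (auto simp: algebra_simps)
    have "t = 0"
      using power_int_affine_at_three_points[OF assms(1-3)] eq by blast
    then show "z powi f = 1"
      using eq powers by simp
  next
    assume "z powi f = 1"
    then have "row 2 (A_mat a b c z) = (of_int b / of_int a) *s row 1 (A_mat a b c z)"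
      "row 3 (A_mat a b c z) = (of_int c / of_int a) *s row 1 (A_mat a b c z)"
      using assms(1) powers by (auto simp: row_A_mat vec_eq_iff forall_2)
    moreover have "row 1 (A_mat a b c z) = 1 *s row 1 (A_mat a b c z)"
      by simp
    ultimately show "rank (A_mat a b c z) = 1"
      unfolding rank forall_3 by blast
  qed
qed

end
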